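(* Let $M\in\mathbb R_+^{m\times m}$ be an entrywise nonnegative matrix, and let $\boldsymbol\Delta$ and $\boldsymbol\Theta$ be the sets of block diagonal $m\times m$ matrices defined in the context. Then the following are equivalent: (a) $\mu(M,\boldsymbol\Delta)<1$; (b) there exists $\Theta\in\boldsymbol\Theta$ such that $\left\|\Theta^{\frac12}M\Theta^{-\frac12}\right\|<1$.
   Context: Fix block sizes $m_1,\dots,m_N\ge1$ with $m_1+\dots+m_N=m$ (blocks of size $1$ allowed). Let $$\boldsymbol\Delta:=\{\mathrm{diag}(\Delta_1,\dots,\Delta_N):\ \Delta_k\in\mathbb R_+^{m_k\times m_k},\ 1\le k\le N\},\qquad \boldsymbol\Theta:=\{\mathrm{diag}(\theta_1I_{m_1},\dots,\theta_NI_{m_N}):\ \theta_k>0,\ 1\le k\le N\},$$ where $\mathbb R_+=[0,\infty)$. $\|\cdot\|$ is the spectral norm (largest singular value). For $A\in\mathbb C^{m\times m}$ and a set $\mathbf D\subset\mathbb C^{m\times m}$, the structured singular value is $$\mu(A,\mathbf D):=\frac1{\inf\{\|\Delta\|:\Delta\in\mathbf D,\ \det(I-A\Delta)=0\}},$$ with $\mu(A,\mathbf D)=0$ if no $\Delta\in\mathbf D$ satisfies $\det(I-A\Delta)=0$. *)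

theory Defs
  imports "HOL-Analysis.Analysis"
begin

definition conj_transpose :: "complex ^ 'n ^ 'm \<Rightarrow> complex ^ 'm ^ 'n" where
  "conj_transpose A = (\<chi> i j. cnj (A $ j $ i))"

definition singular_values :: "complex ^ 'n::finite ^ 'm::finite \<Rightarrow> real set" where
  "singular_values A =
     {\<sigma>. \<sigma> \<ge> 0 \<and>
        (\<exists>v. v \<noteq> 0 \<and> (conj_transpose A ** A) *v v = complex_of_real (\<sigma>\<^sup>2) *s v)}"

definition spectral_norm :: "complex ^ 'n::finite ^ 'm::finite \<Rightarrow> real" where
  "spectral_norm A = Max (singular_values A)"

definition structured_singular_value ::
    "complex ^ 'm::finite ^ 'm \<Rightarrow> (complex ^ 'm ^ 'm) set \<Rightarrow> real" where
  "structured_singular_value A D =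
     (if \<exists>\<Delta>\<in>D. det (mat 1 - A ** \<Delta>) = 0
      then 1 / Inf {spectral_norm \<Delta> | \<Delta>. \<Delta> \<in> D \<and> det (mat 1 - A ** \<Delta>) = 0}
      else 0)"

definition complex_matrix :: "real ^ 'n ^ 'm \<Rightarrow> complex ^ 'n ^ 'm" where
  "complex_matrix A = (\<chi> i j. complex_of_real (A $ i $ j))"

text \<open>
  Matrix indices range over a finite linearly ordered type; the position of an index, counted from
  \<open>0\<close>, is the number of its predecessors. Given a list \<open>ms\<close> of block sizes, block \<open>k\<close> consists of the
  indices whose positions are at least \<open>offset ms k\<close> and less than \<open>offset ms (Suc k)\<close>.
\<close>

definition position :: "'m::{finite,linorder} \<Rightarrow> nat" where
  "position i = card {j. j < i}"

definition offset :: "nat list \<Rightarrow> nat \<Rightarrow> nat" where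
  "offset ms k = sum_list (take k ms)"

definition in_block :: "nat list \<Rightarrow> nat \<Rightarrow> 'm::{finite,linorder} \<Rightarrow> bool" where
  "in_block ms k i \<longleftrightarrow> offset ms k \<le> position i \<and> position i < offset ms (Suc k)"

text \<open>
  The matrix with diagonal blocks \<open>B 0, \<dots>, B (length ms - 1)\<close>, where \<open>B k p q\<close> is the \<open>(p, q)\<close> entry of
  the \<open>k\<close>-th block for \<open>p, q < ms ! k\<close>. Blocks are disjoint, so at most one summand is nonzero.
\<close>

definition block_diag ::
    "nat list \<Rightarrow> (nat \<Rightarrow> nat \<Rightarrow> nat \<Rightarrow> real) \<Rightarrow> real ^ ('m::{finite,linorder}) ^ ('m::{finite,linorder})" where
  "block_diag ms B =
     (\<chi> i j. \<Sum>k<length ms.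
        if in_block ms k i \<and> in_block ms k j
        then B k (position i - offset ms k) (position j - offset ms k) else 0)"

definition nonneg_block_diag :: "nat list \<Rightarrow> (real ^ ('m::{finite,linorder}) ^ ('m::{finite,linorder})) set" where
  "nonneg_block_diag ms =
     {block_diag ms B | B. \<forall>k<length ms. \<forall>p<ms ! k. \<forall>q<ms ! k. B k p q \<ge> 0}"

definition pos_scalar_block_diag :: "nat list \<Rightarrow> (real ^ ('m::{finite,linorder}) ^ ('m::{finite,linorder})) set" where
  "pos_scalar_block_diag ms =
     {block_diag ms (\<lambda>k p q. if p = q then \<theta> k else 0) | \<theta>. \<forall>k<length ms. \<theta> k > 0}"

definition psd :: "real ^ 'm::finite ^ 'm \<Rightarrow> bool" where
  "psd A \<longleftrightarrow> transpose A = A \<and> (\<forall>x. 0 \<le> x \<bullet> (A *v x))"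

text \<open>Well defined on positive semidefinite matrices only, whose psd square root is unique.\<close>

definition psd_sqrt :: "real ^ 'm::finite ^ 'm \<Rightarrow> real ^ 'm ^ 'm" where
  "psd_sqrt A = (THE S. psd S \<and> S ** S = A)"

end

theory Submission
  imports Defs
begin

text \<open>
  The easy direction: the scaling commutes with every \<open>\<Delta>\<close>, so a fixed vector of \<open>M \<Delta>\<close> yields one of
  the scaled product, forcing \<open>\<parallel>\<Delta>\<parallel> \<ge> 1 / \<parallel>\<Theta>\<^bsup>1/2\<^esup> M \<Theta>\<^bsup>-1/2\<^esup>\<parallel> > 1\<close>.

  Conversely, put \<open>\<phi>\<^sub>k x = \<parallel>(M x)\<^sub>k\<parallel>\<^sup>2 - \<parallel>x\<^sub>k\<parallel>\<^sup>2\<close>. If \<open>x \<ge> 0\<close> is nonzero and all \<open>\<phi>\<^sub>k x \<ge> 0\<close>, rank-one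
  nonnegative blocks of norm at most \<open>1\<close> map \<open>M x\<close> to \<open>x\<close>, contradicting (a). In the coordinates
  \<open>y\<^sub>i = x\<^sub>i\<^sup>2\<close> each \<open>\<phi>\<^sub>k\<close> is concave because \<open>M\<close> is nonnegative and \<open>(p, q) \<mapsto> sqrt (p q)\<close> is concave.
  Hence the set of vectors lying below some value of \<open>\<phi>\<close> on the simplex is closed and convex and
  misses \<open>0\<close>, and a separating hyperplane provides weights \<open>\<theta>\<^sub>k\<close> with \<open>\<Sum>\<^sub>k \<theta>\<^sub>k \<phi>\<^sub>k x < 0\<close>. Replacing \<open>x\<close> by
  its entrywise modulus extends this to all real \<open>x \<noteq> 0\<close>.
\<close>

section \<open>The spectral norm\<close>

lemma norm_vec_squared:
  fixes x :: "'a::real_normed_vector ^ 'n"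
  shows "(norm x)\<^sup>2 = (\<Sum>i\<in>UNIV. (norm (x $ i))\<^sup>2)"
  by (simp add: norm_vec_def L2_set_def sum_nonneg)

text \<open>Here \<open>\<bullet>\<close> is the real inner product on complex vectors, the real
  part of the Hermitian one. Interchanging the two sums moves the matrix across.\<close>

lemma conj_transpose_adjoint:
  fixes A :: "complex ^ 'n::finite ^ 'm::finite"
  shows "(A *v x) \<bullet> y = x \<bullet> (conj_transpose A *v y)"
proof -
  have inner: "z \<bullet> w = Re (z * cnj w)" for z w :: complex
    by (simp add: inner_complex_def)
  have "(A *v x) \<bullet> y = (\<Sum>i\<in>UNIV. \<Sum>j\<in>UNIV. Re (A $ i $ j * x $ j * cnj (y $ i)))"
    unfolding inner_vec_def inner matrix_vector_mult_def vec_lambda_beta sum_distrib_right Re_sum ..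
  also have "\<dots> = (\<Sum>j\<in>UNIV. \<Sum>i\<in>UNIV. Re (A $ i $ j * x $ j * cnj (y $ i)))"
    by (rule sum.swap)
  also have "\<dots> = (\<Sum>j\<in>UNIV. \<Sum>i\<in>UNIV. Re (x $ j * cnj (cnj (A $ i $ j) * y $ i)))"
    by (simp only: complex_cnj_mult complex_cnj_cnj ac_simps)
  also have "\<dots> = x \<bullet> (conj_transpose A *v y)"
    unfolding inner_vec_def inner matrix_vector_mult_def conj_transpose_def vec_lambda_beta
      sum_distrib_left Re_sum cnj_sum ..
  finally show ?thesis .
qed

text \<open>The unit sphere is compact, so the continuous map \<open>norm (f x)\<close> has a
  maximizer on it; scaling shows that its value bounds \<open>f\<close> everywhere.\<close>

lemma onorm_attained:
  fixes f :: "'a::euclidean_space \<Rightarrow> 'b::real_normed_vector"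
  assumes "bounded_linear f"
  obtains v where "norm v = 1" "norm (f v) = onorm f"
proof -
  interpret f: bounded_linear f by fact
  obtain e :: 'a where "e \<in> Basis" using nonempty_Basis by blast
  then have "sphere (0::'a) 1 \<noteq> {}" by (auto intro: exI[of _ e])
  moreover have "continuous_on (sphere 0 1) (\<lambda>x. norm (f x))"
    by (intro continuous_intros f.continuous_on)
  ultimately obtain v where v: "norm v = 1" "\<And>y. norm y = 1 \<Longrightarrow> norm (f y) \<le> norm (f v)"
    using continuous_attains_sup[OF compact_sphere, of 0 1 "\<lambda>x. norm (f x)"] by auto
  have "onorm f \<le> norm (f v)"
  proof (rule onorm_bound)
    fix x
    show "norm (f x) \<le> norm (f v) * norm x"
    proof (cases "x = 0")
      case False
      then have "norm (f (x /\<^sub>R norm x)) \<le> norm (f v)" by (intro v(2)) simp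
      with False show ?thesis by (simp add: f.scaleR field_simps)
    qed (simp add: f.zero)
  qed simp
  moreover have "norm (f v) \<le> onorm f" using onorm[OF assms, of v] v(1) by simp
  ultimately show thesis using that v(1) by auto
qed

text \<open>Near \<open>t = 0\<close> a nonzero linear term dominates and takes both signs. This
  serves as the first-order condition at a minimum.\<close>

lemma nonneg_quadratic_linear_term_eq_0:
  fixes b c :: real
  assumes "\<And>t. 0 \<le> 2 * t * b + t\<^sup>2 * c"
  shows "b = 0"
proof (rule ccontr)
  assume "b \<noteq> 0"
  \<comment> \<open>At \<open>t = - b / d\<close> the form is a positive multiple of
    \<open>c - 2 * d\<close>, negative because \<open>d\<close> is positive and exceeds
    \<open>c\<close>.\<close>
  define d where "d = \<bar>c\<bar> + 1"
  have d: "d > 0" "c < d" unfolding d_def by auto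
  have "0 \<le> 2 * (- b / d) * b + (- b / d)\<^sup>2 * c" by (rule assms)
  also have "\<dots> = b\<^sup>2 / d\<^sup>2 * (c - 2 * d)"
    using d by (simp add: power2_eq_square field_simps)
  also have "\<dots> < 0" using d \<open>b \<noteq> 0\<close> by (intro mult_pos_neg) auto
  finally show False by simp
qed

lemma norm_add_scaleR_squared:
  fixes x y :: "'a::real_inner"
  shows "(norm (x + t *\<^sub>R y))\<^sup>2 = (norm x)\<^sup>2 + 2 * t * (x \<bullet> y) + t\<^sup>2 * (y \<bullet> y)"
proof -
  have "(norm (x + t *\<^sub>R y))\<^sup>2 = x \<bullet> x + 2 * t * (x \<bullet> y) + t\<^sup>2 * (y \<bullet> y)"
    unfolding power2_norm_eq_inner inner_add_left inner_add_right inner_scaleR_left inner_scaleR_right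
      inner_commute[of y x] by (simp add: power2_eq_square algebra_simps)
  then show ?thesis by (simp only: power2_norm_eq_inner)
qed

text \<open>Weak form of the eigenvalue equation: testing against all \<open>w\<close> in the real
  inner product determines a vector, and \<open>c\<close> is real.\<close>

lemma gram_eigenvalue_iff:
  fixes A :: "complex ^ 'n::finite ^ 'm::finite"
  shows "(conj_transpose A ** A) *v v = complex_of_real c *s v \<longleftrightarrow>
    (\<forall>w. (A *v v) \<bullet> (A *v w) = c * (v \<bullet> w))"
proof -
  have s: "complex_of_real c *s v = c *\<^sub>R v"
    by (simp add: vec_eq_iff) (simp add: scaleR_conv_of_real)
  have "(A *v v) \<bullet> (A *v w) = ((conj_transpose A ** A) *v v) \<bullet> w" for w
    using conj_transpose_adjoint[of A w "A *v v"]
    by (simp add: inner_commute flip: matrix_vector_mul_assoc)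
  then show ?thesis unfolding s
    by (metis inner_scaleR_left vector_eq_rdot)
qed

lemma singular_value_eq:
  assumes "v \<noteq> 0" "\<sigma> \<ge> 0" "(conj_transpose A ** A) *v v = complex_of_real (\<sigma>\<^sup>2) *s v"
  shows "norm (A *v v) = \<sigma> * norm v"
proof -
  have "(norm (A *v v))\<^sup>2 = (\<sigma> * norm v)\<^sup>2"
    using assms(3) unfolding gram_eigenvalue_iff
    by (simp add: power_mult_distrib power2_norm_eq_inner)
  then show ?thesis using assms(2) by (simp add: power2_eq_iff_nonneg)
qed

text \<open>Eigenvectors for distinct singular values are orthogonal and nonzero, and a
  finite-dimensional space holds only finitely many such vectors. Finiteness gives the
  \<open>Max\<close> in \<open>spectral_norm\<close> its meaning.\<close>

lemma finite_singular_values: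
  fixes A :: "complex ^ 'n::finite ^ 'm::finite"
  shows "finite (singular_values A)"
proof -
  define V where "V \<sigma> = (SOME v. v \<noteq> 0 \<and> (conj_transpose A ** A) *v v = complex_of_real (\<sigma>\<^sup>2) *s v)" for \<sigma>
  have V: "V \<sigma> \<noteq> 0" "(A *v V \<sigma>) \<bullet> (A *v w) = \<sigma>\<^sup>2 * (V \<sigma> \<bullet> w)" if "\<sigma> \<in> singular_values A" for \<sigma> w
  proof -
    have "V \<sigma> \<noteq> 0 \<and> (conj_transpose A ** A) *v V \<sigma> = complex_of_real (\<sigma>\<^sup>2) *s V \<sigma>"
      using that unfolding V_def singular_values_def by - (rule someI_ex, blast)
    then show "V \<sigma> \<noteq> 0" "(A *v V \<sigma>) \<bullet> (A *v w) = \<sigma>\<^sup>2 * (V \<sigma> \<bullet> w)"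
      unfolding gram_eigenvalue_iff by auto
  qed
  have orth: "V \<sigma> \<bullet> V \<tau> = 0" if "\<sigma> \<in> singular_values A" "\<tau> \<in> singular_values A" "\<sigma> \<noteq> \<tau>" for \<sigma> \<tau>
  proof -
    \<comment> \<open>Both sides equal the inner product of the images of \<open>V \<sigma>\<close>
      and \<open>V \<tau>\<close> under \<open>A\<close>.\<close>
    have "\<sigma>\<^sup>2 * (V \<sigma> \<bullet> V \<tau>) = \<tau>\<^sup>2 * (V \<sigma> \<bullet> V \<tau>)"
      using V(2)[OF that(1), of "V \<tau>"] V(2)[OF that(2), of "V \<sigma>"] by (simp add: inner_commute)
    moreover have "\<sigma>\<^sup>2 \<noteq> \<tau>\<^sup>2"
      using that by (auto simp: singular_values_def power2_eq_iff_nonneg)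
    ultimately show ?thesis by simp
  qed
  have "inj_on V (singular_values A)"
  proof (rule inj_onI, rule ccontr)
    fix \<sigma> \<tau> assume "\<sigma> \<in> singular_values A" "\<tau> \<in> singular_values A" "V \<sigma> = V \<tau>" "\<sigma> \<noteq> \<tau>"
    then show False using orth[of \<sigma> \<tau>] V(1)[of \<sigma>] by simp
  qed
  moreover have "finite (V ` singular_values A)"
    by (rule pairwise_orthogonal_imp_finite)
      (auto simp: pairwise_def orthogonal_def intro!: orth)
  ultimately show ?thesis using finite_imageD by blast
qed

text \<open>A unit vector of maximal stretch is an eigenvector of the Gram matrix, so the operator
  norm is a singular value. Every singular value is the stretch factor of some vector, so none is
  larger.\<close>

theorem spectral_norm_eq_onorm:
  fixes A :: "complex ^ 'n::finite ^ 'm::finite"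
  shows "spectral_norm A = onorm ((*v) A)"
proof -
  let ?s = "onorm ((*v) A)"
  have bl: "bounded_linear ((*v) A)" by simp
  interpret bounded_linear "(*v) A" by (fact bl)
  have s: "?s \<ge> 0" by (rule onorm_pos_le[OF bl])
  obtain v where v: "norm v = 1" "norm (A *v v) = ?s" using onorm_attained[OF bl] by blast
  have "(A *v v) \<bullet> (A *v w) = ?s\<^sup>2 * (v \<bullet> w)" for w
  proof -
    \<comment> \<open>\<open>v\<close> minimizes the nonnegative quadratic form \<open>s\<^sup>2 |u|\<^sup>2 - |A u|\<^sup>2\<close>, whose value at \<open>v\<close> is \<open>0\<close>.\<close>
    have "0 \<le> 2 * t * (?s\<^sup>2 * (v \<bullet> w) - (A *v v) \<bullet> (A *v w)) + t\<^sup>2 * (?s\<^sup>2 * (w \<bullet> w) - (A *v w) \<bullet> (A *v w))" for t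
    proof -
      have "(norm (A *v (v + t *\<^sub>R w)))\<^sup>2 \<le> (?s * norm (v + t *\<^sub>R w))\<^sup>2"
        by (intro power_mono onorm[OF bl]) auto
      moreover have "(norm (A *v (v + t *\<^sub>R w)))\<^sup>2 =
          (norm (A *v v))\<^sup>2 + 2 * t * ((A *v v) \<bullet> (A *v w)) + t\<^sup>2 * ((A *v w) \<bullet> (A *v w))"
        by (simp only: add scaleR norm_add_scaleR_squared)
      moreover have "(norm (v + t *\<^sub>R w))\<^sup>2 = 1 + 2 * t * (v \<bullet> w) + t\<^sup>2 * (w \<bullet> w)"
        using v(1) by (simp add: norm_add_scaleR_squared)
      ultimately show ?thesis using v(2) by (simp add: power_mult_distrib algebra_simps)
    qed
    then show ?thesis using nonneg_quadratic_linear_term_eq_0 by fastforce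
  qed
  then have "?s \<in> singular_values A"
    using s v(1) unfolding singular_values_def mem_Collect_eq gram_eigenvalue_iff
    by (intro conjI exI[of _ v]) auto
  moreover have "\<sigma> \<le> ?s" if "\<sigma> \<in> singular_values A" for \<sigma>
  proof -
    obtain u where u: "u \<noteq> 0" "norm (A *v u) = \<sigma> * norm u"
      using \<open>\<sigma> \<in> singular_values A\<close> singular_value_eq unfolding singular_values_def by blast
    then have "\<sigma> * norm u \<le> ?s * norm u" using onorm[OF bl, of u] by simp
    with u(1) show ?thesis by simp
  qed
  ultimately show ?thesis unfolding spectral_norm_def
    by (intro Max_eqI finite_singular_values) auto
qed

section \<open>Real matrices acting on complex vectors\<close>

lemma norm_complex_matrix_mult:
  fixes B :: "real ^ 'n::finite ^ 'm::finite"
  shows "(norm (complex_matrix B *v v))\<^sup>2 =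
    (norm (B *v (\<chi> i. Re (v $ i))))\<^sup>2 + (norm (B *v (\<chi> i. Im (v $ i))))\<^sup>2"
proof -
  have "(complex_matrix B *v v) $ i =
      Complex ((B *v (\<chi> i. Re (v $ i))) $ i) ((B *v (\<chi> i. Im (v $ i))) $ i)" for i
    by (simp add: complex_eq_iff complex_matrix_def matrix_vector_mult_def)
  then show ?thesis by (simp add: norm_vec_squared cmod_power2 sum.distrib)
qed

lemma norm_Re_Im:
  fixes v :: "complex ^ 'n::finite"
  shows "(norm v)\<^sup>2 = (norm (\<chi> i. Re (v $ i)))\<^sup>2 + (norm (\<chi> i. Im (v $ i)))\<^sup>2"
  by (simp add: norm_vec_squared cmod_power2 sum.distrib)

text \<open>A real matrix acts separately on real and imaginary parts, so the real bound applies to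
  each; conversely, real vectors embed isometrically into complex ones.\<close>

lemma spectral_norm_complex_matrix:
  fixes B :: "real ^ 'n::finite ^ 'm::finite"
  shows "spectral_norm (complex_matrix B) = onorm ((*v) B)"
  unfolding spectral_norm_eq_onorm
proof (rule antisym)
  let ?c = "onorm ((*v) B)"
  have blB: "bounded_linear ((*v) B)" and blC: "bounded_linear ((*v) (complex_matrix B))" by simp_all
  have c: "?c \<ge> 0" by (rule onorm_pos_le[OF blB])
  show "onorm ((*v) (complex_matrix B)) \<le> ?c"
  proof (rule onorm_bound[OF c])
    fix v :: "complex ^ 'n"
    have "(norm (B *v x))\<^sup>2 \<le> ?c\<^sup>2 * (norm x)\<^sup>2" for x
      using power_mono[OF onorm[OF blB, of x], of 2] by (simp add: power_mult_distrib)
    then have "(norm (complex_matrix B *v v))\<^sup>2 \<le> (?c * norm v)\<^sup>2"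
      unfolding norm_complex_matrix_mult power_mult_distrib norm_Re_Im[of v] distrib_left
      by (intro add_mono)
    then show "norm (complex_matrix B *v v) \<le> ?c * norm v"
      using c by (intro power2_le_imp_le[of "norm (complex_matrix B *v v)"]) auto
  qed
  show "?c \<le> onorm ((*v) (complex_matrix B))"
  proof (rule onorm_bound[OF onorm_pos_le[OF blC]])
    fix x :: "real ^ 'n"
    let ?v = "(\<chi> i. complex_of_real (x $ i))"
    have z: "(\<chi> i. 0) = (0 :: real ^ 'n)" by (simp add: vec_eq_iff)
    have "(norm (complex_matrix B *v ?v))\<^sup>2 = (norm (B *v x))\<^sup>2"
      by (simp add: norm_complex_matrix_mult z)
    moreover have "(norm ?v)\<^sup>2 = (norm x)\<^sup>2" by (simp add: norm_Re_Im z)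
    ultimately show "norm (B *v x) \<le> onorm ((*v) (complex_matrix B)) * norm x"
      using onorm[OF blC, of ?v] by (simp add: power2_eq_iff_nonneg)
  qed
qed

lemma onorm_matrix_less_1:
  fixes B :: "real ^ 'n::finite ^ 'm::finite"
  assumes "\<And>v. v \<noteq> 0 \<Longrightarrow> norm (B *v v) < norm v"
  shows "onorm ((*v) B) < 1"
proof -
  obtain v where "norm v = 1" "norm (B *v v) = onorm ((*v) B)"
    by (rule onorm_attained[of "(*v) B"]) auto
  with assms[of v] show ?thesis by force
qed

section \<open>Singularity of the feedback matrix\<close>

lemma complex_matrix_det:
  "det (complex_matrix B) = complex_of_real (det B)"
  by (simp add: det_def complex_matrix_def)

lemma det_complex_matrix_feedback:
  fixes A B :: "real ^ 'n::finite ^ 'n"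
  shows "det (mat 1 - complex_matrix A ** complex_matrix B) = 0 \<longleftrightarrow> det (mat 1 - A ** B) = 0"
proof -
  have "mat 1 - complex_matrix A ** complex_matrix B = complex_matrix (mat 1 - A ** B)"
    by (simp add: complex_matrix_def matrix_matrix_mult_def mat_def vec_eq_iff)
  then show ?thesis by (simp add: complex_matrix_det)
qed

text \<open>A square matrix is singular exactly when its kernel is nontrivial; a kernel vector here
  is a fixed vector of the product.\<close>

lemma det_feedback_eq_0_iff:
  fixes A B :: "real ^ 'n::finite ^ 'n"
  shows "det (mat 1 - A ** B) = 0 \<longleftrightarrow> (\<exists>v. v \<noteq> 0 \<and> A *v (B *v v) = v)"
proof -
  have "det (mat 1 - A ** B) = 0 \<longleftrightarrow> \<not> (\<forall>v. (mat 1 - A ** B) *v v = 0 \<longrightarrow> v = 0)"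
    using matrix_left_invertible_ker[of "mat 1 - A ** B"]
    by (metis invertible_det_nz invertible_left_inverse)
  also have "\<dots> \<longleftrightarrow> (\<exists>v. v \<noteq> 0 \<and> A *v (B *v v) = v)"
    unfolding matrix_vector_mult_diff_rdistrib matrix_vector_mul_lid right_minus_eq
      matrix_vector_mul_assoc[symmetric] by metis
  finally show ?thesis .
qed

section \<open>Concavity and separation\<close>

text \<open>For \<open>s + t = 1\<close> this is the concavity of a squared component of
  \<open>M x\<close> as a function of the squares of the entries of \<open>x\<close>.\<close>

lemma weighted_sum_sqrt_squared_concave:
  fixes m y z :: "'a \<Rightarrow> real"
  assumes "\<And>l. l \<in> L \<Longrightarrow> m l \<ge> 0" "\<And>l. l \<in> L \<Longrightarrow> y l \<ge> 0" "\<And>l. l \<in> L \<Longrightarrow> z l \<ge> 0"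
    and "s \<ge> 0" "t \<ge> 0"
  shows "s * (\<Sum>l\<in>L. m l * sqrt (y l))\<^sup>2 + t * (\<Sum>l\<in>L. m l * sqrt (z l))\<^sup>2
    \<le> (\<Sum>l\<in>L. m l * sqrt (s * y l + t * z l))\<^sup>2"
proof -
  \<comment> \<open>The triangle inequality for these vectors in the plane.\<close>
  define w where "w l = Complex (sqrt s * (m l * sqrt (y l))) (sqrt t * (m l * sqrt (z l)))" for l
  have w: "cmod (w l) = m l * sqrt (s * y l + t * z l)" if "l \<in> L" for l
  proof -
    have "cmod (w l) = sqrt ((m l)\<^sup>2 * (s * y l + t * z l))"
      using that assms unfolding w_def by (simp add: complex_norm power_mult_distrib algebra_simps)
    then show ?thesis using that assms by (simp add: real_sqrt_mult)
  qed
  have "s * (\<Sum>l\<in>L. m l * sqrt (y l))\<^sup>2 + t * (\<Sum>l\<in>L. m l * sqrt (z l))\<^sup>2 = (cmod (\<Sum>l\<in>L. w l))\<^sup>2"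
    using assms by (simp add: cmod_power2 w_def power_mult_distrib flip: sum_distrib_left)
  also have "\<dots> \<le> (\<Sum>l\<in>L. cmod (w l))\<^sup>2"
    by (intro power_mono norm_sum) auto
  also have "\<dots> = (\<Sum>l\<in>L. m l * sqrt (s * y l + t * z l))\<^sup>2"
    by (simp add: w cong: sum.cong)
  finally show ?thesis .
qed

text \<open>Separation alone yields weights that may vanish. Its strict gap \<open>b\<close>,
  together with boundedness of the image, leaves room to make all of them positive.\<close>

lemma pos_functional_neg_on_concave_image:
  fixes G :: "'a::euclidean_space \<Rightarrow> real ^ 'n::finite"
  assumes S: "compact S" "convex S" "S \<noteq> {}" and cont: "continuous_on S G"
    and conc: "\<And>i. concave_on S (\<lambda>y. G y $ i)"
    and neg: "\<And>y. y \<in> S \<Longrightarrow> \<exists>i. G y $ i < 0"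
  obtains w where "\<And>i. w $ i > 0" "\<And>y. y \<in> S \<Longrightarrow> w \<bullet> G y < 0"
proof -
  \<comment> \<open>The image of \<open>G\<close> itself may fail to be convex; concavity makes its
    downward closure convex. Writing \<open>C\<close> as the sum of a compact set and the closed
    negative orthant shows that it is closed.\<close>
  define C where "C = {z. \<exists>y\<in>S. \<forall>i. z $ i \<le> G y $ i}"
  have "C = (\<Union>x\<in>G ` S. \<Union>y\<in>{z. \<forall>i. z $ i \<le> 0}. {x + y})" (is "_ = ?R")
  proof (intro equalityI subsetI)
    fix z assume "z \<in> C"
    then obtain y where "y \<in> S" "\<forall>i. z $ i \<le> G y $ i" by (auto simp: C_def)
    then show "z \<in> ?R" by (auto intro!: bexI[of _ y] exI[of _ "z - G y"])
  next
    fix z assume "z \<in> ?R"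
    then obtain y n where "y \<in> S" "\<forall>i. n $ i \<le> 0" "z = G y + n" by auto
    then show "z \<in> C" by (auto simp: C_def intro!: bexI[of _ y] add_decreasing2)
  qed
  moreover have "closed {z :: real ^ 'n. \<forall>i. z $ i \<le> 0}"
    by (intro closed_Collect_all closed_Collect_le continuous_intros)
  ultimately have "closed C"
    using compact_closed_sums[OF compact_continuous_image[OF cont S(1)]] by simp
  moreover have "convex C"
  proof (rule convexI)
    fix x z and s t :: real assume a: "x \<in> C" "z \<in> C" "0 \<le> s" "0 \<le> t" "s + t = 1"
    then obtain p q where p: "p \<in> S" "\<forall>i. x $ i \<le> G p $ i" and q: "q \<in> S" "\<forall>i. z $ i \<le> G q $ i"
      by (auto simp: C_def)
    have "(s *\<^sub>R x + t *\<^sub>R z) $ i \<le> G (s *\<^sub>R p + t *\<^sub>R q) $ i" for i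
    proof -
      have "(s *\<^sub>R x + t *\<^sub>R z) $ i \<le> s * G p $ i + t * G q $ i"
        using a p q by (auto intro!: add_mono mult_left_mono)
      also have "\<dots> \<le> G (s *\<^sub>R p + t *\<^sub>R q) $ i"
        using conc[of i] a p(1) q(1) unfolding concave_on_iff by blast
      finally show ?thesis .
    qed
    moreover have "s *\<^sub>R p + t *\<^sub>R q \<in> S" using S(2) a p q by (simp add: convexD)
    ultimately show "s *\<^sub>R x + t *\<^sub>R z \<in> C" unfolding C_def by blast
  qed
  moreover have "0 \<notin> C"
  proof
    assume "0 \<in> C"
    then obtain y where "y \<in> S" "\<forall>i. 0 \<le> G y $ i" by (auto simp: C_def)
    with neg[of y] show False by (meson not_le)
  qed
  ultimately obtain a b where ab: "0 < b" "\<And>x. x \<in> C \<Longrightarrow> a \<bullet> x > b"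
    using separating_hyperplane_closed_0[of C] by blast
  have GC: "G y \<in> C" if "y \<in> S" for y using that by (auto simp: C_def)
  have nonpos: "a $ i \<le> 0" for i
  proof (rule ccontr)
    assume "\<not> a $ i \<le> 0"
    then have ai: "a $ i > 0" by simp
    obtain y where y: "y \<in> S" using S(3) by blast
    \<comment> \<open>Lowering coordinate \<open>i\<close> of \<open>G y\<close> by \<open>r\<close>
      stays in \<open>C\<close> but brings the inner product with \<open>a\<close> down to 0, below
      \<open>b\<close>.\<close>
    define r where "r = a \<bullet> G y / a $ i"
    have r: "r \<ge> 0" using ab(1) ab(2)[OF GC[OF y]] ai by (simp add: r_def)
    have "G y - r *\<^sub>R axis i 1 \<in> C" using r y by (auto simp: C_def axis_def intro!: bexI[of _ y])
    from ab(2)[OF this] show False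
      using ai ab(1) by (simp add: inner_diff_right inner_axis r_def)
  qed
  have "compact (G ` S)" using compact_continuous_image[OF cont S(1)] .
  then obtain B where B: "\<And>y. y \<in> S \<Longrightarrow> norm (G y) \<le> B" "B > 0"
    by (metis bounded_pos compact_imp_bounded imageI)
  define n :: "real ^ 'n" where "n = (\<chi> i. 1)"
  have nn: "norm n > 0" by (simp add: n_def vec_eq_iff)
  \<comment> \<open>With this \<open>d\<close> the perturbation contributes
    \<open>d * (n \<bullet> G y) \<le> b\<close>, while \<open>a \<bullet> G y\<close> exceeds
    \<open>b\<close>.\<close>
  define d where "d = b / (norm n * B)"
  have d: "d > 0" using ab B nn by (simp add: d_def)
  show thesis
  proof (rule that)
    show "(d *\<^sub>R n - a) $ i > 0" for i using nonpos[of i] d by (simp add: n_def)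
    fix y assume y: "y \<in> S"
    have "n \<bullet> G y \<le> norm n * B"
      using norm_cauchy_schwarz[of n "G y"] B(1)[OF y] by (meson mult_left_mono norm_ge_zero order_trans)
    then have "d * (n \<bullet> G y) \<le> d * (norm n * B)" using d by simp
    also have "\<dots> = b" using nn B(2) by (simp add: d_def)
    finally show "(d *\<^sub>R n - a) \<bullet> G y < 0"
      using ab(2)[OF GC[OF y]] by (simp add: inner_diff_left)
  qed
qed

text \<open>Exchanging the sums turns weights on indices into weights on blocks: the coefficient of
  \<open>f j\<close> depends on \<open>j\<close> only through \<open>b j\<close>.\<close>

lemma sum_grouped_weights:
  fixes f :: "'m::finite \<Rightarrow> real"
  shows "(\<Sum>i\<in>UNIV. w i * (\<Sum>j | b j = b i. f j)) = (\<Sum>j\<in>UNIV. (\<Sum>i | b i = b j. w i) * f j)"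
proof -
  have "(\<Sum>i\<in>UNIV. w i * (\<Sum>j | b j = b i. f j)) = (\<Sum>i\<in>UNIV. \<Sum>j\<in>UNIV. if b i = b j then w i * f j else 0)"
    by (auto simp: sum_distrib_left sum.If_cases Int_def eq_commute intro!: sum.cong)
  also have "\<dots> = (\<Sum>j\<in>UNIV. \<Sum>i\<in>UNIV. if b i = b j then w i * f j else 0)"
    by (rule sum.swap)
  also have "\<dots> = (\<Sum>j\<in>UNIV. (\<Sum>i | b i = b j. w i) * f j)"
    by (auto simp: sum_distrib_right sum.If_cases Int_def intro!: sum.cong)
  finally show ?thesis .
qed

text \<open>The map \<open>b\<close> labels each index by its block. The hypothesis
  \<open>block_loss\<close> says that every nonzero nonnegative vector loses norm on some block;
  separation turns this into one weighted inequality for all vectors.\<close>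

lemma exists_diagonal_scaling:
  fixes M :: "real ^ 'm::finite ^ 'm" and b :: "'m \<Rightarrow> 'k"
  assumes nonneg: "\<And>i j. M $ i $ j \<ge> 0"
    and block_loss: "\<And>x. x \<noteq> 0 \<Longrightarrow> (\<And>i. x $ i \<ge> 0) \<Longrightarrow>
      \<exists>i. (\<Sum>j | b j = b i. ((M *v x) $ j)\<^sup>2) < (\<Sum>j | b j = b i. (x $ j)\<^sup>2)"
  obtains \<theta> where "\<And>k. \<theta> k > (0::real)"
    "\<And>x. x \<noteq> 0 \<Longrightarrow> (\<Sum>j\<in>UNIV. \<theta> (b j) * ((M *v x) $ j)\<^sup>2) < (\<Sum>j\<in>UNIV. \<theta> (b j) * (x $ j)\<^sup>2)"
proof -
  \<comment> \<open>The coordinates are indices rather than blocks: the value for a block is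
    repeated at each of its members.\<close>
  define F :: "real ^ 'm \<Rightarrow> real ^ 'm"
    where "F x = (\<chi> i. \<Sum>j | b j = b i. ((M *v x) $ j)\<^sup>2 - (x $ j)\<^sup>2)" for x
  \<comment> \<open>On nonnegative vectors \<open>r\<close> inverts entrywise squaring, so
    \<open>F (r y)\<close> is \<open>F\<close> in the squared coordinates.\<close>
  define r :: "real ^ 'm \<Rightarrow> real ^ 'm" where "r y = (\<chi> i. sqrt (y $ i))" for y
  define S :: "(real ^ 'm) set" where "S = {y. (\<forall>i. y $ i \<ge> 0) \<and> (\<Sum>i\<in>UNIV. y $ i) = 1}"
  have "closed S" unfolding S_def
    by (intro closed_Collect_conj closed_Collect_all closed_Collect_le closed_Collect_eq continuous_intros)
  moreover have "bounded S" unfolding bounded_iff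
  proof (intro exI ballI)
    fix y assume "y \<in> S"
    then show "norm y \<le> 1" using norm_le_l1_cart[of y] by (simp add: S_def)
  qed
  ultimately have "compact S" by (simp add: compact_eq_bounded_closed)
  have "convex S" by (rule convexI) (auto simp: S_def sum.distrib simp flip: sum_distrib_left)
  have "axis undefined 1 \<in> S" by (auto simp: S_def axis_def)
  then have "S \<noteq> {}" by blast
  have "continuous_on S (\<lambda>y. F (r y))"
    unfolding F_def r_def matrix_vector_mult_def by (intro continuous_intros)
  have conc: "concave_on S (\<lambda>y. F (r y) $ i)" for i
    unfolding concave_on_iff
  proof (intro conjI ballI allI impI \<open>convex S\<close>)
    fix y z and s t :: real
    assume a: "y \<in> S" "z \<in> S" "0 \<le> s" "0 \<le> t" "s + t = 1"
    have nn: "y $ l \<ge> 0" "z $ l \<ge> 0" "s * y $ l + t * z $ l \<ge> 0" for l using a by (auto simp: S_def)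
    have "s * ((M *v r y) $ j)\<^sup>2 + t * ((M *v r z) $ j)\<^sup>2 \<le> ((M *v r (s *\<^sub>R y + t *\<^sub>R z)) $ j)\<^sup>2" for j
      using weighted_sum_sqrt_squared_concave[of UNIV "\<lambda>l. M $ j $ l" "\<lambda>l. y $ l" "\<lambda>l. z $ l" s t] nonneg nn a
      by (simp add: matrix_vector_mult_def r_def)
    then have "(\<Sum>j | b j = b i. s * (((M *v r y) $ j)\<^sup>2 - y $ j) + t * (((M *v r z) $ j)\<^sup>2 - z $ j))
        \<le> (\<Sum>j | b j = b i. ((M *v r (s *\<^sub>R y + t *\<^sub>R z)) $ j)\<^sup>2 - (s * y $ j + t * z $ j))"
      by (intro sum_mono) (simp add: algebra_simps add_mono)
    \<comment> \<open>In these coordinates the subtracted term is linear, so it does not affect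
      concavity.\<close>
    moreover have "F (r y) $ i = (\<Sum>j | b j = b i. ((M *v r y) $ j)\<^sup>2 - y $ j)" if "\<And>l. y $ l \<ge> 0" for y
      using that by (simp add: F_def r_def)
    ultimately show "s * F (r y) $ i + t * F (r z) $ i \<le> F (r (s *\<^sub>R y + t *\<^sub>R z)) $ i"
      using nn by (simp add: sum.distrib sum_distrib_left)
  qed
  have neg: "\<exists>i. F (r y) $ i < 0" if "y \<in> S" for y
  proof -
    have "r y \<noteq> 0"
    proof
      assume "r y = 0"
      then have "y = 0" by (simp add: r_def vec_eq_iff)
      with that show False by (simp add: S_def)
    qed
    moreover have "r y $ i \<ge> 0" for i using that by (simp add: S_def r_def)
    ultimately show ?thesis using block_loss[of "r y"] by (simp add: F_def sum_subtractf)
  qed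
  obtain w where w: "\<And>i. w $ i > 0" "\<And>y. y \<in> S \<Longrightarrow> w \<bullet> F (r y) < 0"
    using pos_functional_neg_on_concave_image[of S "\<lambda>y. F (r y)"] conc neg
      \<open>compact S\<close> \<open>convex S\<close> \<open>S \<noteq> {}\<close> \<open>continuous_on S (\<lambda>y. F (r y))\<close> by blast
  \<comment> \<open>The weights of the repeated coordinates add up over a block; the value 1 keeps
    \<open>\<theta>\<close> positive at labels that \<open>b\<close> never takes.\<close>
  define \<theta> where "\<theta> k = (if k \<in> range b then \<Sum>i | b i = k. w $ i else 1)" for k
  have wF: "w \<bullet> F x = (\<Sum>j\<in>UNIV. \<theta> (b j) * ((M *v x) $ j)\<^sup>2) - (\<Sum>j\<in>UNIV. \<theta> (b j) * (x $ j)\<^sup>2)" for x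
    by (simp add: F_def inner_vec_def sum_grouped_weights \<theta>_def right_diff_distrib sum_subtractf)
  show thesis
  proof (rule that)
    show "\<theta> k > 0" for k using w(1) by (auto simp: \<theta>_def intro!: sum_pos)
    then have \<theta>: "\<theta> k \<ge> 0" for k using less_imp_le by blast
    fix x :: "real ^ 'm" assume x: "x \<noteq> 0"
    \<comment> \<open>The normalised modulus \<open>a\<close> of \<open>x\<close> has squared
      entries \<open>y\<close> summing to 1, so \<open>y\<close> lies in the simplex.\<close>
    define a :: "real ^ 'm" where "a = (\<chi> i. \<bar>x $ i\<bar> / norm x)"
    define y :: "real ^ 'm" where "y = (\<chi> i. (x $ i)\<^sup>2 / (norm x)\<^sup>2)"
    have "(\<Sum>i\<in>UNIV. y $ i) = (norm x)\<^sup>2 / (norm x)\<^sup>2"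
      by (simp add: y_def norm_vec_squared flip: sum_divide_distrib)
    then have "y \<in> S" using x by (simp add: S_def y_def)
    moreover have "r y = a" by (simp add: r_def y_def a_def vec_eq_iff real_sqrt_divide)
    ultimately have "(\<Sum>j\<in>UNIV. \<theta> (b j) * ((M *v a) $ j)\<^sup>2) < (\<Sum>j\<in>UNIV. \<theta> (b j) * (a $ j)\<^sup>2)"
      using w(2) wF[of a] by fastforce
    then have "(norm x)\<^sup>2 * (\<Sum>j\<in>UNIV. \<theta> (b j) * ((M *v a) $ j)\<^sup>2) < (norm x)\<^sup>2 * (\<Sum>j\<in>UNIV. \<theta> (b j) * (a $ j)\<^sup>2)"
      using x by simp
    also have "\<dots> = (\<Sum>j\<in>UNIV. \<theta> (b j) * (x $ j)\<^sup>2)"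
      using x by (simp add: a_def sum_distrib_left power_divide)
    finally have "(\<Sum>j\<in>UNIV. \<theta> (b j) * (norm x * (M *v a) $ j)\<^sup>2) < (\<Sum>j\<in>UNIV. \<theta> (b j) * (x $ j)\<^sup>2)"
      by (simp add: sum_distrib_left power_mult_distrib mult.left_commute)
    \<comment> \<open>Passing to the modulus can only enlarge the components of \<open>M x\<close>,
      since \<open>M\<close> is nonnegative, and it preserves the squares of the entries of
      \<open>x\<close>.\<close>
    moreover have "((M *v x) $ j)\<^sup>2 \<le> (norm x * (M *v a) $ j)\<^sup>2" for j
    proof -
      have "\<bar>(M *v x) $ j\<bar> \<le> (\<Sum>l\<in>UNIV. M $ j $ l * \<bar>x $ l\<bar>)"
        unfolding matrix_vector_mult_def using nonneg
        by (auto intro!: order_trans[OF sum_abs] sum_mono simp: abs_mult)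
      also have "\<dots> = norm x * (M *v a) $ j"
        using x by (simp add: matrix_vector_mult_def a_def sum_distrib_left)
      finally show ?thesis by (rule power2_mono[of _ _, OF order_trans]) auto
    qed
    then have "(\<Sum>j\<in>UNIV. \<theta> (b j) * ((M *v x) $ j)\<^sup>2) \<le> (\<Sum>j\<in>UNIV. \<theta> (b j) * (norm x * (M *v a) $ j)\<^sup>2)"
      by (intro sum_mono mult_left_mono \<theta>)
    ultimately show "(\<Sum>j\<in>UNIV. \<theta> (b j) * ((M *v x) $ j)\<^sup>2) < (\<Sum>j\<in>UNIV. \<theta> (b j) * (x $ j)\<^sup>2)"
      by linarith
  qed
qed

text \<open>On a block where \<open>y\<close> is nonzero, the rank-one map has norm equal to the
  ratio of the norms of \<open>x\<close> and \<open>y\<close> there, at most 1 by \<open>le\<close>.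
  With \<open>y = M x\<close> it provides a perturbation that contradicts (a).\<close>

lemma exists_block_contraction_fixing:
  fixes x y :: "real ^ 'm::finite" and b :: "'m \<Rightarrow> 'k"
  assumes x: "\<And>i. x $ i \<ge> 0" and y: "\<And>i. y $ i \<ge> 0"
    and le: "\<And>i. (\<Sum>j | b j = b i. (x $ j)\<^sup>2) \<le> (\<Sum>j | b j = b i. (y $ j)\<^sup>2)"
  obtains \<Delta> where "\<And>i j. \<Delta> $ i $ j \<ge> 0" "\<And>i j. b i \<noteq> b j \<Longrightarrow> \<Delta> $ i $ j = 0"
    "\<Delta> *v y = x" "onorm ((*v) \<Delta>) \<le> 1"
proof -
  \<comment> \<open>Each block is \<open>x y\<^sup>T / |y|\<^sup>2\<close>, and \<open>0\<close> by the junk value of division if \<open>y\<close> vanishes on it.\<close>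
  define s where "s k = (\<Sum>j | b j = k. (y $ j)\<^sup>2)" for k
  have s: "s k \<ge> 0" for k unfolding s_def by (intro sum_nonneg) auto
  define \<Delta> :: "real ^ 'm ^ 'm" where "\<Delta> = (\<chi> i j. if b j = b i then x $ i * y $ j / s (b i) else 0)"
  have mult: "(\<Delta> *v u) $ i = x $ i * (\<Sum>j | b j = b i. y $ j * u $ j) / s (b i)" for u i
  proof -
    have "(\<Delta> *v u) $ i = (\<Sum>j\<in>UNIV. if b j = b i then x $ i * y $ j / s (b i) * u $ j else 0)"
      unfolding matrix_vector_mult_def \<Delta>_def by (auto intro!: sum.cong)
    also have "\<dots> = (\<Sum>j | b j = b i. x $ i * y $ j / s (b i) * u $ j)"
      by (simp add: sum.If_cases Int_def)
    finally show ?thesis by (simp add: sum_distrib_left sum_divide_distrib mult.assoc)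
  qed
  show thesis
  proof (rule that)
    show "\<Delta> $ i $ j \<ge> 0" for i j using x y s by (simp add: \<Delta>_def)
    show "\<Delta> $ i $ j = 0" if "b i \<noteq> b j" for i j using that by (simp add: \<Delta>_def)
    show "\<Delta> *v y = x" unfolding vec_eq_iff
    proof
      fix i
      have "(\<Delta> *v y) $ i = x $ i * s (b i) / s (b i)" by (simp add: mult s_def power2_eq_square)
      \<comment> \<open>Where \<open>y\<close> vanishes on a block, \<open>le\<close> forces
        \<open>x\<close> to vanish there as well, in agreement with the zero block.\<close>
      moreover have "x $ i = 0" if "s (b i) = 0"
      proof -
        have "(\<Sum>j | b j = b i. (x $ j)\<^sup>2) = 0"
          using le[of i] that by (intro antisym sum_nonneg) (auto simp: s_def)
        then show ?thesis by (subst (asm) sum_nonneg_eq_0_iff) auto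
      qed
      ultimately show "(\<Delta> *v y) $ i = x $ i" by auto
    qed
    show "onorm ((*v) \<Delta>) \<le> 1"
    proof (rule onorm_bound)
      fix u :: "real ^ 'm"
      have "((\<Delta> *v u) $ i)\<^sup>2 \<le> (x $ i)\<^sup>2 / s (b i) * (\<Sum>j | b j = b i. (u $ j)\<^sup>2)" for i
      proof -
        have "((\<Delta> *v u) $ i)\<^sup>2 = (x $ i)\<^sup>2 / (s (b i))\<^sup>2 * (\<Sum>j | b j = b i. y $ j * u $ j)\<^sup>2"
          by (simp add: mult power_mult_distrib power_divide)
        also have "\<dots> \<le> (x $ i)\<^sup>2 / (s (b i))\<^sup>2 * (s (b i) * (\<Sum>j | b j = b i. (u $ j)\<^sup>2))"
          unfolding s_def by (intro mult_left_mono Cauchy_Schwarz_ineq_sum) auto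
        also have "\<dots> = (x $ i)\<^sup>2 / s (b i) * (\<Sum>j | b j = b i. (u $ j)\<^sup>2)"
          by (simp add: power2_eq_square)
        finally show ?thesis .
      qed
      then have "(norm (\<Delta> *v u))\<^sup>2 \<le> (\<Sum>i\<in>UNIV. (x $ i)\<^sup>2 / s (b i) * (\<Sum>j | b j = b i. (u $ j)\<^sup>2))"
        by (simp add: norm_vec_squared sum_mono)
      \<comment> \<open>After regrouping, the coefficient of each squared entry of \<open>u\<close>
        is the ratio of the squared block norms of \<open>x\<close> and \<open>y\<close>, or 0 if
        \<open>y\<close> vanishes on the block.\<close>
      also have "\<dots> = (\<Sum>j\<in>UNIV. (\<Sum>i | b i = b j. (x $ i)\<^sup>2 / s (b i)) * (u $ j)\<^sup>2)"
        by (rule sum_grouped_weights)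
      also have "\<dots> \<le> (\<Sum>j\<in>UNIV. 1 * (u $ j)\<^sup>2)"
      proof (intro sum_mono mult_right_mono)
        fix j
        have "(\<Sum>i | b i = b j. (x $ i)\<^sup>2 / s (b i)) = (\<Sum>i | b i = b j. (x $ i)\<^sup>2) / s (b j)"
          by (simp add: sum_divide_distrib)
        also have "\<dots> \<le> 1" using le[of j] s[of "b j"] by (cases "s (b j) = 0") (simp_all only: s_def[symmetric] divide_le_eq_1 div_by_0, auto)
        finally show "(\<Sum>i | b i = b j. (x $ i)\<^sup>2 / s (b i)) \<le> 1" .
      qed simp
      also have "\<dots> = (norm u)\<^sup>2" by (simp add: norm_vec_squared)
      finally have "(norm (\<Delta> *v u))\<^sup>2 \<le> (norm u)\<^sup>2" .
      from power2_le_imp_le[OF this norm_ge_zero] show "norm (\<Delta> *v u) \<le> 1 * norm u" by simp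
    qed simp
  qed
qed

section \<open>Diagonal and block diagonal matrices\<close>

definition diag_matrix :: "('m \<Rightarrow> real) \<Rightarrow> real ^ 'm ^ 'm" where
  "diag_matrix d = (\<chi> i j. if i = j then d i else 0)"

lemma diag_matrix_vector_mult: "(diag_matrix d *v x) $ i = d i * x $ i"
  by (simp add: diag_matrix_def matrix_vector_mult_def if_distrib[of "\<lambda>c. c * _"] cong: if_cong)

lemma diag_matrix_mult_left: "(diag_matrix d ** A) $ i $ j = d i * A $ i $ j"
  by (simp add: diag_matrix_def matrix_matrix_mult_def if_distrib[of "\<lambda>c. c * _"] cong: if_cong)

lemma diag_matrix_mult_right: "(A ** diag_matrix d) $ i $ j = A $ i $ j * d j"
  by (simp add: diag_matrix_def matrix_matrix_mult_def if_distrib[of "\<lambda>c. _ * c"] cong: if_cong)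

lemma diag_matrix_mult: "diag_matrix c ** diag_matrix d = diag_matrix (\<lambda>i. c i * d i)"
  by (simp add: vec_eq_iff diag_matrix_mult_left) (simp add: diag_matrix_def)

lemma matrix_inv_unique:
  assumes "A ** B = mat 1" "B ** A = mat 1"
  shows "matrix_inv A = B"
proof -
  have "A ** matrix_inv A = mat 1 \<and> matrix_inv A ** A = mat 1"
    unfolding matrix_inv_def using assms by - (rule someI[of _ B], simp)
  then show ?thesis by (metis assms(2) matrix_mul_assoc matrix_mul_lid matrix_mul_rid)
qed

lemma matrix_inv_diag_matrix:
  assumes "\<And>i. d i \<noteq> 0"
  shows "matrix_inv (diag_matrix d) = diag_matrix (\<lambda>i. inverse (d i))"
  by (rule matrix_inv_unique)
    (use assms in \<open>simp_all add: diag_matrix_mult\<close>, simp_all add: diag_matrix_def mat_def)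

text \<open>As \<open>psd_sqrt\<close> is a definite description, the obvious root must also be
  shown to be the only one.\<close>

lemma psd_sqrt_diag_matrix:
  fixes d :: "'m::finite \<Rightarrow> real"
  assumes d: "\<And>i. d i > 0"
  shows "psd_sqrt (diag_matrix d) = diag_matrix (\<lambda>i. sqrt (d i))"
  unfolding psd_sqrt_def
proof (rule the_equality)
  let ?R = "diag_matrix (\<lambda>i. sqrt (d i))"
  have quad: "x \<bullet> (?R *v x) = (\<Sum>i\<in>UNIV. sqrt (d i) * (x $ i)\<^sup>2)" for x
    by (simp add: inner_vec_def diag_matrix_vector_mult power2_eq_square algebra_simps)
  have d': "d i \<ge> 0" for i using d[of i] by simp
  have RR: "?R ** ?R = diag_matrix d" using d' by (simp add: diag_matrix_mult)
  have "transpose ?R = ?R" by (simp add: transpose_def diag_matrix_def vec_eq_iff)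
  moreover have "0 \<le> x \<bullet> (?R *v x)" for x unfolding quad using d' by (intro sum_nonneg) simp
  ultimately show "psd ?R \<and> ?R ** ?R = diag_matrix d" using RR by (simp add: psd_def)
  fix S assume S: "psd S \<and> S ** S = diag_matrix d"
  \<comment> \<open>\<open>S\<close> commutes with \<open>S\<^sup>2\<close>, so it vanishes off the eigenspaces of \<open>S\<^sup>2\<close> and commutes with \<open>R\<close>.\<close>
  have "S ** diag_matrix d = diag_matrix d ** S" using S by (metis matrix_mul_assoc)
  then have "S $ i $ j * d j = d i * S $ i $ j" for i j
    by (metis diag_matrix_mult_left diag_matrix_mult_right)
  then have "S $ i $ j = 0 \<or> d i = d j" for i j by (metis mult.commute mult_cancel_right)
  then have "S $ i $ j * sqrt (d j) = sqrt (d i) * S $ i $ j" for i j by (metis mult.commute mult_zero_left)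
  then have comm: "S ** ?R = ?R ** S"
    by (simp add: vec_eq_iff diag_matrix_mult_left diag_matrix_mult_right)
  have "(S - ?R) *v x = 0" for x
  proof -
    \<comment> \<open>Commutation gives \<open>(S + ?R) *v y = 0\<close>. Both quadratic forms are
      nonnegative, so both vanish at \<open>y\<close>, and \<open>?R\<close> is positive
      definite.\<close>
    define y where "y = (S - ?R) *v x"
    have "S *v (S *v x) = ?R *v (?R *v x)" "S *v (?R *v x) = ?R *v (S *v x)"
      using S RR comm by (simp_all add: matrix_vector_mul_assoc)
    then have "S *v y + ?R *v y = 0"
      by (simp add: y_def matrix_vector_mult_diff_rdistrib matrix_vector_mult_diff_distrib)
    then have "y \<bullet> (S *v y) + y \<bullet> (?R *v y) = 0" by (metis inner_add_right inner_zero_right)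
    moreover have "0 \<le> y \<bullet> (S *v y)" using S by (simp add: psd_def)
    ultimately have "y \<bullet> (?R *v y) = 0" using \<open>\<And>x. 0 \<le> x \<bullet> (?R *v x)\<close>[of y] by linarith
    then have "\<forall>i. sqrt (d i) * (y $ i)\<^sup>2 = 0"
      unfolding quad using d' by (subst (asm) sum_nonneg_eq_0_iff) auto
    then have "\<forall>i. y $ i = 0" using d by (metis less_irrefl mult_eq_0_iff power2_eq_square real_sqrt_eq_zero_cancel_iff)
    then show ?thesis by (simp add: y_def vec_eq_iff)
  qed
  then show "S = ?R" by (metis matrix_eq matrix_vector_mult_0 right_minus_eq)
qed

section \<open>Positions of indices and the block labelling\<close>

lemma inj_position: "inj (position :: 'm::{finite,linorder} \<Rightarrow> nat)"
proof (rule linorder_inj_onI')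
  fix i j :: 'm assume "i < j"
  then show "position i \<noteq> position j"
    unfolding position_def by (intro less_imp_neq psubset_card_mono) auto
qed

lemma position_less_card: "position (i :: 'm::{finite,linorder}) < CARD('m)"
  unfolding position_def by (intro psubset_card_mono) auto

lemma offset_Suc: "k < length ms \<Longrightarrow> offset ms (Suc k) = offset ms k + ms ! k"
  by (simp add: offset_def take_Suc_conv_app_nth)

lemma offset_mono:
  assumes "j \<le> k"
  shows "offset ms j \<le> offset ms k"
proof (rule lift_Suc_mono_le[OF _ assms])
  \<comment> \<open>Past the end of \<open>ms\<close> the offset stays constant, because
    \<open>take\<close> returns the whole list.\<close>
  show "offset ms n \<le> offset ms (Suc n)" for n
    by (cases "n < length ms") (simp add: offset_Suc, simp add: offset_def)
qed

lemma offset_length: "offset ms (length ms) = sum_list ms"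
  by (simp add: offset_def)

lemma in_block_unique:
  assumes "in_block ms k i" "in_block ms l i"
  shows "k = l"
proof (rule ccontr)
  assume "k \<noteq> l"
  then have "offset ms (Suc k) \<le> offset ms l \<or> offset ms (Suc l) \<le> offset ms k"
    using offset_mono[of "Suc k" l ms] offset_mono[of "Suc l" k ms] by linarith
  with assms show False by (auto simp: in_block_def)
qed

lemma exists_in_block:
  fixes i :: "'m::{finite,linorder}"
  assumes "sum_list ms = CARD('m)"
  shows "\<exists>k<length ms. in_block ms k i"
proof -
  have "\<exists>k<n. in_block ms k i" if "position i < offset ms n" for n
    using that
  proof (induction n)
    case (Suc n)
    then show ?case by (cases "position i < offset ms n") (auto simp: in_block_def less_Suc_eq)
  qed (simp add: offset_def)
  from this[of "length ms"] show ?thesis using assms position_less_card[of i] by (simp add: offset_length)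
qed

text \<open>Block membership becomes a labelling function \<open>b\<close>, through which the block
  structure enters the rest of the argument.\<close>

lemma obtain_block_index:
  assumes "sum_list ms = CARD('m::{finite,linorder})"
  obtains b :: "'m::{finite,linorder} \<Rightarrow> nat" where "\<And>i. b i < length ms" "\<And>k i. in_block ms k i \<longleftrightarrow> k = b i"
proof -
  obtain b :: "'m \<Rightarrow> nat" where "\<And>i. b i < length ms \<and> in_block ms (b i) i"
    using exists_in_block[OF assms] by metis
  with that show thesis using in_block_unique by metis
qed

lemma block_diag_component:
  fixes i j :: "'m::{finite,linorder}"
  assumes "\<And>i::'m. b i < length ms" "\<And>k (i::'m). in_block ms k i \<longleftrightarrow> k = b i"
  shows "block_diag ms B $ i $ j =
    (if b i = b j then B (b i) (position i - offset ms (b i)) (position j - offset ms (b i)) else 0)"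
  using assms(1) by (auto simp: block_diag_def assms(2) sum.delta if_distrib cong: conj_cong if_cong
      intro!: sum.neutral)

lemma nonneg_block_diag_iff:
  fixes A :: "real ^ ('m::{finite,linorder}) ^ ('m::{finite,linorder})"
  assumes b: "\<And>i::'m. b i < length ms" "\<And>k (i::'m). in_block ms k i \<longleftrightarrow> k = b i"
  shows "A \<in> nonneg_block_diag ms \<longleftrightarrow>
    (\<forall>i j. A $ i $ j \<ge> 0) \<and> (\<forall>i j. b i \<noteq> b j \<longrightarrow> A $ i $ j = 0)"
proof
  have pos: "offset ms (b i) \<le> position i" "position i - offset ms (b i) < ms ! b i" for i :: 'm
  proof -
    have "in_block ms (b i) i" using b(2) by simp
    then show "offset ms (b i) \<le> position i" "position i - offset ms (b i) < ms ! b i"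
      using b(1)[of i] by (auto simp: in_block_def offset_Suc)
  qed
  {
    assume "A \<in> nonneg_block_diag ms"
    then show "(\<forall>i j. A $ i $ j \<ge> 0) \<and> (\<forall>i j. b i \<noteq> b j \<longrightarrow> A $ i $ j = 0)"
      using pos(2) b(1) by (auto simp: nonneg_block_diag_def block_diag_component[OF b]) (metis pos(2))
  next
    assume A: "(\<forall>i j. A $ i $ j \<ge> 0) \<and> (\<forall>i j. b i \<noteq> b j \<longrightarrow> A $ i $ j = 0)"
    \<comment> \<open>Block entries are read off \<open>A\<close> through the inverse of
      \<open>position\<close>. Even at arguments outside the range of \<open>position\<close> the
      value is some entry of \<open>A\<close>, hence nonnegative.\<close>
    define B where "B k p q = A $ (inv position (offset ms k + p)) $ (inv position (offset ms k + q))" for k p q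
    have "A = block_diag ms B"
      using A pos(1) unfolding vec_eq_iff block_diag_component[OF b] B_def
      by (auto simp: inj_position) (metis inj_position inv_f_f le_add_diff_inverse pos(1))
    moreover have "B k p q \<ge> 0" for k p q using A by (simp add: B_def)
    ultimately show "A \<in> nonneg_block_diag ms" unfolding nonneg_block_diag_def by blast
  }
qed

lemma pos_scalar_block_diag_iff:
  fixes A :: "real ^ ('m::{finite,linorder}) ^ ('m::{finite,linorder})"
  assumes b: "\<And>i::'m. b i < length ms" "\<And>k (i::'m). in_block ms k i \<longleftrightarrow> k = b i"
  shows "A \<in> pos_scalar_block_diag ms \<longleftrightarrow>
    (\<exists>\<theta>. (\<forall>k<length ms. \<theta> k > 0) \<and> A = diag_matrix (\<lambda>i. \<theta> (b i)))"
proof -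
  have "block_diag ms (\<lambda>k p q. if p = q then \<theta> k else 0) = diag_matrix (\<lambda>i::'m. \<theta> (b i))" for \<theta>
  proof -
    have "position i - offset ms (b i) = position j - offset ms (b i) \<longleftrightarrow> i = j"
      if "b i = b j" for i j :: 'm
    proof -
      \<comment> \<open>Subtraction on naturals truncates; these bounds let the differences
        determine the positions.\<close>
      have "offset ms (b i) \<le> position i" "offset ms (b i) \<le> position j"
        using b(2)[of "b i" i] b(2)[of "b i" j] that by (auto simp: in_block_def)
      then show ?thesis using injD[OF inj_position, of i j] by auto
    qed
    then show ?thesis by (auto simp: vec_eq_iff block_diag_component[OF b] diag_matrix_def)
  qed
  then show ?thesis by (auto simp: pos_scalar_block_diag_def)
qed

section \<open>The structured singular value\<close>

text \<open>All matrices involved are real, so admissible perturbations are those with a real fixed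
  vector, measured by the real operator norm.\<close>

lemma structured_singular_value_complex_matrix:
  fixes M :: "real ^ 'm::finite ^ 'm"
  shows "structured_singular_value (complex_matrix M) (complex_matrix ` D) =
    (let U = {\<Delta> \<in> D. \<exists>v. v \<noteq> 0 \<and> M *v (\<Delta> *v v) = v}
     in if U = {} then 0 else 1 / (INF \<Delta>\<in>U. onorm ((*v) \<Delta>)))"
proof -
  have "{spectral_norm \<Delta> | \<Delta>. \<Delta> \<in> complex_matrix ` D \<and> det (mat 1 - complex_matrix M ** \<Delta>) = 0} =
      (\<lambda>\<Delta>. onorm ((*v) \<Delta>)) ` {\<Delta> \<in> D. \<exists>v. v \<noteq> 0 \<and> M *v (\<Delta> *v v) = v}"
    by (force simp: det_complex_matrix_feedback det_feedback_eq_0_iff spectral_norm_complex_matrix)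
  then show ?thesis
    unfolding structured_singular_value_def Let_def
    by (auto simp: det_complex_matrix_feedback det_feedback_eq_0_iff)
qed

text \<open>Small-gain estimate: the product of the norms bounds the stretch of the fixed vector,
  which is 1.\<close>

lemma onorm_feedback_ge:
  fixes A B :: "real ^ 'n::finite ^ 'n"
  assumes "v \<noteq> 0" "A *v (B *v v) = v"
  shows "1 \<le> onorm ((*v) A) * onorm ((*v) B)"
proof -
  have "norm v \<le> onorm ((*v) A) * norm (B *v v)"
    using onorm[of "(*v) A" "B *v v"] assms(2) by simp
  also have "\<dots> \<le> onorm ((*v) A) * (onorm ((*v) B) * norm v)"
    by (intro mult_left_mono onorm onorm_pos_le) auto
  finally have "1 * norm v \<le> (onorm ((*v) A) * onorm ((*v) B)) * norm v" by (simp add: mult.assoc)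
  then show ?thesis by (rule mult_right_le_imp_le) (use assms(1) in simp)
qed

text \<open>The lower bound \<open>1 / c\<close> is uniform over the admissible perturbations, so it
  passes to the infimum and keeps it strictly above 1.\<close>

lemma structured_singular_value_less_1I:
  fixes M :: "real ^ 'm::finite ^ 'm"
  assumes "c < 1"
    and ge: "\<And>\<Delta> v. \<Delta> \<in> D \<Longrightarrow> v \<noteq> 0 \<Longrightarrow> M *v (\<Delta> *v v) = v \<Longrightarrow> 1 \<le> c * onorm ((*v) \<Delta>)"
  shows "structured_singular_value (complex_matrix M) (complex_matrix ` D) < 1"
proof -
  define U where "U = {\<Delta> \<in> D. \<exists>v. v \<noteq> 0 \<and> M *v (\<Delta> *v v) = v}"
  have ge': "1 \<le> c * onorm ((*v) \<Delta>)" if "\<Delta> \<in> U" for \<Delta> using that ge by (auto simp: U_def)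
  have "1 / (INF \<Delta>\<in>U. onorm ((*v) \<Delta>)) < 1" if "U \<noteq> {}"
  proof -
    obtain \<Delta> where "\<Delta> \<in> U" using \<open>U \<noteq> {}\<close> by blast
    then have "0 < c * onorm ((*v) \<Delta>)" using ge'[of \<Delta>] by linarith
    moreover have "0 \<le> onorm ((*v) \<Delta>)" by (rule onorm_pos_le) simp
    ultimately have "c > 0" by (simp add: zero_less_mult_iff)
    then have "1 / c \<le> (INF \<Delta>\<in>U. onorm ((*v) \<Delta>))"
      using ge' by (intro cINF_greatest that) (simp add: field_simps)
    moreover have "1 < 1 / c" using \<open>c > 0\<close> \<open>c < 1\<close> by simp
    ultimately show ?thesis by simp
  qed
  then show ?thesis unfolding structured_singular_value_complex_matrix Let_def U_def[symmetric] by simp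
qed

text \<open>A zero infimum would give the value \<open>1 / 0 = 0\<close> and hence no information.
  The small-gain bound by the reciprocal norm of \<open>M\<close> excludes this, and then the
  infimum exceeds 1.\<close>

lemma structured_singular_value_less_1D:
  fixes M :: "real ^ 'm::finite ^ 'm"
  assumes "structured_singular_value (complex_matrix M) (complex_matrix ` D) < 1"
    and "\<Delta> \<in> D" "v \<noteq> 0" "M *v (\<Delta> *v v) = v"
  shows "1 < onorm ((*v) \<Delta>)"
proof -
  define U where "U = {\<Delta> \<in> D. \<exists>v. v \<noteq> 0 \<and> M *v (\<Delta> *v v) = v}"
  have \<Delta>: "\<Delta> \<in> U" using assms by (auto simp: U_def)
  have ge: "1 \<le> onorm ((*v) M) * onorm ((*v) \<Delta>)" if "\<Delta> \<in> U" for \<Delta>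
    using that onorm_feedback_ge by (auto simp: U_def)
  have "onorm ((*v) M) \<ge> 0" by (rule onorm_pos_le) simp
  with ge[OF \<Delta>] have M: "onorm ((*v) M) > 0" by (cases "onorm ((*v) M) = 0") auto
  then have "1 / onorm ((*v) M) \<le> (INF \<Delta>\<in>U. onorm ((*v) \<Delta>))"
    using ge \<Delta> by (intro cINF_greatest) (auto simp: field_simps)
  moreover have "1 / onorm ((*v) M) > 0" using M by simp
  ultimately have "0 < (INF \<Delta>\<in>U. onorm ((*v) \<Delta>))" by linarith
  moreover have "1 / (INF \<Delta>\<in>U. onorm ((*v) \<Delta>)) < 1"
    using assms(1) \<Delta> unfolding structured_singular_value_complex_matrix Let_def U_def[symmetric]
    by (auto split: if_splits)
  ultimately have "1 < (INF \<Delta>\<in>U. onorm ((*v) \<Delta>))" by (simp add: divide_less_eq_1)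
  moreover have "(INF \<Delta>\<in>U. onorm ((*v) \<Delta>)) \<le> onorm ((*v) \<Delta>)"
    using \<Delta> by (intro cINF_lower bdd_belowI2[of _ 0] onorm_pos_le) auto
  ultimately show ?thesis by linarith
qed

theorem theorem8:
  fixes M :: "real ^ ('m::{finite,linorder}) ^ ('m::{finite,linorder})" and ms :: "nat list"
  assumes block_sizes: "\<forall>k<length ms. ms ! k \<ge> 1"
    and total_size: "sum_list ms = CARD('m)"
    and nonneg: "\<forall>i j. M $ i $ j \<ge> 0"
  shows "structured_singular_value (complex_matrix M) (complex_matrix ` nonneg_block_diag ms) < 1 \<longleftrightarrow>
    (\<exists>\<Theta>\<in>pos_scalar_block_diag ms.
       spectral_norm (complex_matrix (psd_sqrt \<Theta> ** M ** matrix_inv (psd_sqrt \<Theta>))) < 1)"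
proof -
  obtain b :: "'m \<Rightarrow> nat" where b: "\<And>i. b i < length ms" "\<And>k i. in_block ms k i \<longleftrightarrow> k = b i"
    using obtain_block_index[OF total_size] by metis
  define N where "N \<theta> = diag_matrix (\<lambda>i. sqrt (\<theta> (b i))) ** M ** diag_matrix (\<lambda>i. inverse (sqrt (\<theta> (b i))))"
    for \<theta> :: "nat \<Rightarrow> real"
  have N: "psd_sqrt \<Theta> ** M ** matrix_inv (psd_sqrt \<Theta>) = N \<theta>"
    if "\<Theta> = diag_matrix (\<lambda>i. \<theta> (b i))" "\<forall>k<length ms. \<theta> k > 0" for \<Theta> \<theta>
  proof -
    have "\<theta> (b i) > 0" for i using that(2) b(1) by simp
    moreover from this have "sqrt (\<theta> (b i)) \<noteq> 0" for i by (metis less_irrefl real_sqrt_eq_zero_cancel_iff)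
    ultimately show ?thesis by (simp add: that(1) N_def psd_sqrt_diag_matrix matrix_inv_diag_matrix)
  qed
  have "(\<exists>\<Theta>\<in>pos_scalar_block_diag ms.
       spectral_norm (complex_matrix (psd_sqrt \<Theta> ** M ** matrix_inv (psd_sqrt \<Theta>))) < 1) \<longleftrightarrow>
     (\<exists>\<theta>. (\<forall>k<length ms. \<theta> k > 0) \<and> onorm ((*v) (N \<theta>)) < 1)"
    unfolding Bex_def pos_scalar_block_diag_iff[OF b] spectral_norm_complex_matrix using N by metis
  also have "\<dots> \<longleftrightarrow> structured_singular_value (complex_matrix M) (complex_matrix ` nonneg_block_diag ms) < 1"
  proof
    assume "\<exists>\<theta>. (\<forall>k<length ms. \<theta> k > 0) \<and> onorm ((*v) (N \<theta>)) < 1"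
    then obtain \<theta> where \<theta>: "\<And>i. \<theta> (b i) > 0" "onorm ((*v) (N \<theta>)) < 1" using b(1) by blast
    let ?R = "diag_matrix (\<lambda>i. sqrt (\<theta> (b i)))" and ?R' = "diag_matrix (\<lambda>i. inverse (sqrt (\<theta> (b i))))"
    have sq: "sqrt (\<theta> (b i)) > 0" for i using \<theta>(1) by simp
    show "structured_singular_value (complex_matrix M) (complex_matrix ` nonneg_block_diag ms) < 1"
    proof (rule structured_singular_value_less_1I[OF \<theta>(2)])
      fix \<Delta> v assume a: "\<Delta> \<in> nonneg_block_diag ms" "v \<noteq> 0" "M *v (\<Delta> *v v) = v"
      \<comment> \<open>The scaling is constant on each block, and \<open>\<Delta>\<close> vanishes
        between different blocks.\<close>
      have "\<Delta> ** ?R = ?R ** \<Delta>"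
        using a(1) unfolding nonneg_block_diag_iff[OF b]
        by (auto simp: vec_eq_iff diag_matrix_mult_left diag_matrix_mult_right) (metis mult.commute mult_zero_left)
      then have "\<Delta> *v (?R *v v) = ?R *v (\<Delta> *v v)" by (simp add: matrix_vector_mul_assoc)
      moreover have R': "?R' *v (?R *v x) = x" for x
        using sq by (simp add: vec_eq_iff diag_matrix_vector_mult less_imp_neq[symmetric])
      ultimately have "N \<theta> *v (\<Delta> *v (?R *v v)) = ?R *v v"
        using a(3) by (simp add: N_def R' flip: matrix_vector_mul_assoc)
      moreover have "?R *v v \<noteq> 0" using a(2) R'[of v] by (metis matrix_vector_mult_0_right)
      ultimately show "1 \<le> onorm ((*v) (N \<theta>)) * onorm ((*v) \<Delta>)" using onorm_feedback_ge by blast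
    qed
  next
    assume mu_less: "structured_singular_value (complex_matrix M) (complex_matrix ` nonneg_block_diag ms) < 1"
    have "\<exists>i. (\<Sum>j | b j = b i. ((M *v x) $ j)\<^sup>2) < (\<Sum>j | b j = b i. (x $ j)\<^sup>2)"
      if x: "x \<noteq> 0" "\<And>i. x $ i \<ge> 0" for x
    proof (rule ccontr)
      assume "\<nexists>i. (\<Sum>j | b j = b i. ((M *v x) $ j)\<^sup>2) < (\<Sum>j | b j = b i. (x $ j)\<^sup>2)"
      then have "(\<Sum>j | b j = b i. (x $ j)\<^sup>2) \<le> (\<Sum>j | b j = b i. ((M *v x) $ j)\<^sup>2)" for i
        by (simp add: not_less)
      moreover have "(M *v x) $ i \<ge> 0" for i
        unfolding matrix_vector_mult_def using nonneg x by (auto intro: sum_nonneg)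
      ultimately obtain \<Delta> where \<Delta>: "\<And>i j. \<Delta> $ i $ j \<ge> 0" "\<And>i j. b i \<noteq> b j \<Longrightarrow> \<Delta> $ i $ j = 0"
          "\<Delta> *v (M *v x) = x" "onorm ((*v) \<Delta>) \<le> 1"
        using exists_block_contraction_fixing[of x "M *v x" b] x(2) by blast
      have "\<Delta> \<in> nonneg_block_diag ms" using \<Delta> nonneg_block_diag_iff[OF b] by blast
      \<comment> \<open>The fixed vector of \<open>M ** \<Delta>\<close> is \<open>M *v x\<close>,
        since \<open>\<Delta>\<close> sends it back to \<open>x\<close>.\<close>
      moreover have "M *v x \<noteq> 0" using \<Delta>(3) x(1) by auto
      ultimately have "1 < onorm ((*v) \<Delta>)"
        using structured_singular_value_less_1D[OF mu_less, of \<Delta> "M *v x"] \<Delta>(3) by simp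
      with \<Delta>(4) show False by simp
    qed
    then obtain \<theta> where \<theta>: "\<And>k. \<theta> k > (0::real)"
      "\<And>x. x \<noteq> 0 \<Longrightarrow> (\<Sum>j\<in>UNIV. \<theta> (b j) * ((M *v x) $ j)\<^sup>2) < (\<Sum>j\<in>UNIV. \<theta> (b j) * (x $ j)\<^sup>2)"
      using exists_diagonal_scaling[of M b] nonneg by blast
    have sq: "sqrt (\<theta> (b i)) > 0" for i using \<theta>(1) by simp
    have "onorm ((*v) (N \<theta>)) < 1"
    proof (rule onorm_matrix_less_1)
      fix v :: "(real, 'm) vec" assume v: "v \<noteq> 0"
      \<comment> \<open>Undoing the scaling turns the squared norms of \<open>v\<close> and of
        \<open>N \<theta> *v v\<close> into the weighted sums compared by the choice of
        \<open>\<theta>\<close>.\<close>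
      define x where "x = diag_matrix (\<lambda>i. inverse (sqrt (\<theta> (b i)))) *v v"
      have x: "sqrt (\<theta> (b i)) * x $ i = v $ i" for i
        using sq[of i] by (simp add: x_def diag_matrix_vector_mult)
      have "x \<noteq> 0" using v x by (metis vec_eq_iff mult_zero_right zero_index)
      have "(norm (N \<theta> *v v))\<^sup>2 = (\<Sum>j\<in>UNIV. (sqrt (\<theta> (b j)) * (M *v x) $ j)\<^sup>2)"
        by (simp add: N_def norm_vec_squared x_def diag_matrix_vector_mult flip: matrix_vector_mul_assoc)
      also have "\<dots> = (\<Sum>j\<in>UNIV. \<theta> (b j) * ((M *v x) $ j)\<^sup>2)"
        using \<theta>(1) by (simp add: power_mult_distrib less_imp_le)
      also have "\<dots> < (\<Sum>j\<in>UNIV. \<theta> (b j) * (x $ j)\<^sup>2)" using \<theta>(2) \<open>x \<noteq> 0\<close> .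
      also have "\<dots> = (\<Sum>j\<in>UNIV. (sqrt (\<theta> (b j)) * x $ j)\<^sup>2)"
        using \<theta>(1) by (simp add: power_mult_distrib less_imp_le)
      also have "\<dots> = (norm v)\<^sup>2" by (simp add: x norm_vec_squared)
      finally show "norm (N \<theta> *v v) < norm v" by (rule power2_less_imp_less) simp
    qed
    then show "\<exists>\<theta>. (\<forall>k<length ms. \<theta> k > 0) \<and> onorm ((*v) (N \<theta>)) < 1" using \<theta>(1) by blast
  qed
  finally show ?thesis by simp
qed

end
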